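(* Let $n\ge2$, $1<\mathscr{P}\le n-1$, $N=\binom{n}{\mathscr{P}}$, let $0\le l<k\le N$ be integers and $p,q$ constants with $p=q-l>1$, and let $\varepsilon>0$. Let $\varphi\in C^0(\mathbb{S}^n)$ be positive and let $u\in C^2(\mathbb{S}^n)$ be a positive admissible solution of $$\frac{\sigma_k(\Lambda(\nabla^2u+uI))}{\sigma_l(\Lambda(\nabla^2u+uI))}=u^{p-1+\varepsilon}(u^2+|\nabla u|^2)^{\frac{k+1-q}{2}}\varphi\quad\text{on }\mathbb{S}^n.$$ Then for all $x\in\mathbb{S}^n$, $$\frac{\binom{N}{k}}{\binom{N}{l}}\frac{\mathscr{P}^{k-l}}{\max_{\mathbb{S}^n}\varphi}\le u^{\varepsilon}(x)\le\frac{\binom{N}{k}}{\binom{N}{l}}\frac{\mathscr{P}^{k-l}}{\min_{\mathbb{S}^n}\varphi}.$$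
   Context: $\mathbb{S}^n$ is the unit sphere with its standard metric; $\nabla u$, $\nabla^2u$ are the gradient and covariant Hessian in a local orthonormal frame; $I$ is the identity. Let $\mathbf{I}_1,\dots,\mathbf{I}_N$ enumerate the multi-indices $1\le i_1<\dots<i_{\mathscr{P}}\le n$. For a symmetric matrix $A$ with eigenvalues $\lambda$, $\Lambda(A)=(\Lambda_{\mathbf{I}_1},\dots,\Lambda_{\mathbf{I}_N})$ with $\Lambda_{\mathbf{I}}=\lambda_{i_1}+\dots+\lambda_{i_{\mathscr{P}}}$. $\sigma_m$ is the $m$-th elementary symmetric polynomial, $\sigma_0=1$; $\Gamma_k=\{\mu\in\mathbb{R}^N:\sigma_j(\mu)>0,\ 1\le j\le k\}$. A function $u\in C^2(\mathbb{S}^n)$ is admissible if $\Lambda(\nabla^2u+uI)\in\Gamma_k$ at every point. *)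

theory Defs
  imports "HOL-Analysis.Analysis"
begin

text \<open>The unit sphere S^n is realised as sphere 0 1 in real^'m with CARD('m) = n+1.
A function u on S^n is represented by a function on real^'m of which only the values
on the sphere matter; it is extended 0-homogeneously to the punctured space.\<close>

definition ext0 :: "(real^'m \<Rightarrow> real) \<Rightarrow> real^'m \<Rightarrow> real" where
  "ext0 u x = u (x /\<^sub>R norm x)"

text \<open>First and second (Euclidean) directional derivatives of the 0-homogeneous extension.
At a point x of the sphere and for tangent vectors v, w, D1 u x v = <grad u, v> and
D2 u x v w = (covariant Hessian of u)(v,w), since the radial derivative of ext0 u vanishes.\<close>

definition D1 :: "(real^'m \<Rightarrow> real) \<Rightarrow> real^'m \<Rightarrow> real^'m \<Rightarrow> real" where
  "D1 u x v = frechet_derivative (ext0 u) (at x) v"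

definition D2 :: "(real^'m \<Rightarrow> real) \<Rightarrow> real^'m \<Rightarrow> real^'m \<Rightarrow> real^'m \<Rightarrow> real" where
  "D2 u x v w = frechet_derivative (\<lambda>y. D1 u y v) (at x) w"

definition C2_sphere :: "(real^'m \<Rightarrow> real) \<Rightarrow> bool" where
  "C2_sphere u \<longleftrightarrow>
     (\<forall>x. x \<noteq> 0 \<longrightarrow> ext0 u differentiable (at x)) \<and>
     (\<forall>v x. x \<noteq> 0 \<longrightarrow> (\<lambda>y. D1 u y v) differentiable (at x)) \<and>
     (\<forall>v w. continuous_on (- {0}) (\<lambda>y. D2 u y v w))"

definition tangent_frame :: "nat \<Rightarrow> real^'m \<Rightarrow> (nat \<Rightarrow> real^'m) \<Rightarrow> bool" where
  "tangent_frame n x e \<longleftrightarrow>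
     (\<forall>i<n. e i \<bullet> x = 0) \<and> (\<forall>i<n. \<forall>j<n. e i \<bullet> e j = (if i = j then 1 else 0))"

definition eigen_frame ::
  "(real^'m \<Rightarrow> real) \<Rightarrow> real^'m \<Rightarrow> nat \<Rightarrow> (nat \<Rightarrow> real^'m) \<Rightarrow> (nat \<Rightarrow> real) \<Rightarrow> bool" where
  "eigen_frame u x n e lam \<longleftrightarrow> tangent_frame n x e \<and>
     (\<forall>i<n. \<forall>j<n. D2 u x (e i) (e j) + u x * (if i = j then 1 else 0) = (if i = j then lam i else 0))"

text \<open>Multi-indices 1 <= i_1 < ... < i_P <= n, represented as P-element subsets of {0..<n}.\<close>

definition multi_indices :: "nat \<Rightarrow> nat \<Rightarrow> nat set set" where
  "multi_indices n P = {I. I \<subseteq> {..<n} \<and> card I = P}"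

definition Lam :: "(nat \<Rightarrow> real) \<Rightarrow> nat set \<Rightarrow> real" where
  "Lam lam I = (\<Sum>i\<in>I. lam i)"

definition esym :: "nat \<Rightarrow> 'a set \<Rightarrow> ('a \<Rightarrow> real) \<Rightarrow> real" where
  "esym m S F = (\<Sum>T\<in>{T. T \<subseteq> S \<and> card T = m}. \<Prod>I\<in>T. F I)"

definition in_Gamma :: "nat \<Rightarrow> 'a set \<Rightarrow> ('a \<Rightarrow> real) \<Rightarrow> bool" where
  "in_Gamma k S F \<longleftrightarrow> (\<forall>j. 1 \<le> j \<and> j \<le> k \<longrightarrow> esym j S F > 0)"

end

theory Submission
  imports Defs "HOL-Computational_Algebra.Fundamental_Theorem_Algebra"
begin

text \<open>At a maximum point of \<open>u\<close> the gradient vanishes and the Hessian is nonpositive, so every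
  eigenvalue of \<open>\<nabla>\<^sup>2u + uI\<close> is at most \<open>u\<close> and every \<open>\<Lambda>\<^sub>I\<close> is at most \<open>c = P u\<close>. Write \<open>\<sigma>\<^sub>j(\<mu>|i)\<close>
  for \<open>\<sigma>\<^sub>j\<close> of the variables other than \<open>\<mu>\<^sub>i\<close>. From \<open>(j+1) \<sigma>\<^sub>j\<^sub>+\<^sub>1(\<mu>) = \<Sum>\<^sub>i \<mu>\<^sub>i \<sigma>\<^sub>j(\<mu>|i)\<close>,
  \<open>(N-j) \<sigma>\<^sub>j(\<mu>) = \<Sum>\<^sub>i \<sigma>\<^sub>j(\<mu>|i)\<close> and \<open>\<sigma>\<^sub>j(\<mu>|i) > 0\<close> for \<open>\<mu> \<in> \<Gamma>\<^sub>k\<close>, \<open>j < k\<close>, each ratio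
  \<open>\<sigma>\<^sub>j\<^sub>+\<^sub>1/\<sigma>\<^sub>j\<close> is at most its value at \<open>(c, \<dots>, c)\<close>. Multiplying these bounds for \<open>l \<le> j < k\<close>
  and inserting the equation, where \<open>u\<close> occurs with the exponent \<open>k - l + \<epsilon>\<close>, gives the upper
  bound; a minimum point gives the lower one in the same way. The positivity of \<open>\<sigma>\<^sub>j(\<mu>|i)\<close> rests on
  log-concavity of \<open>j \<mapsto> \<sigma>\<^sub>j\<close>, which holds because derivatives of real-rooted polynomials are
  real-rooted.\<close>

subsection \<open>Real-rooted polynomials\<close>

text \<open>The roots are real but the coefficients complex, so that the fundamental theorem of
  algebra can factor derivatives.\<close>

definition lin_prod :: "real multiset \<Rightarrow> complex poly" where
  "lin_prod A = (\<Prod>a\<in>#A. [:- of_real a, 1:])"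

lemma lin_prod_empty [simp]: "lin_prod {#} = 1"
  by (simp add: lin_prod_def)

lemma lin_prod_add_mset [simp]: "lin_prod (add_mset a A) = [:- of_real a, 1:] * lin_prod A"
  by (simp add: lin_prod_def)

lemma lin_prod_union: "lin_prod (A + B) = lin_prod A * lin_prod B"
  by (simp add: lin_prod_def)

lemma lead_coeff_lin_prod [simp]: "lead_coeff (lin_prod A) = 1"
  by (induction A) (simp_all only: lin_prod_empty lin_prod_add_mset lead_coeff_mult, simp_all)

text \<open>\<open>c = 0\<close> admits the zero polynomial, so the class is closed under repeated
  differentiation.\<close>

definition real_rooted :: "complex poly \<Rightarrow> bool" where
  "real_rooted p \<longleftrightarrow> (\<exists>c A. p = smult (of_real c) (lin_prod A))"

lemma real_rooted_linear: "real_rooted [:1, of_real b:]"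
proof (cases "b = 0")
  case True
  then have "[:1, of_real b:] = smult (of_real 1) (lin_prod {#})"
    by (simp add: one_pCons)
  then show ?thesis unfolding real_rooted_def by blast
next
  case False
  then have "[:1, of_real b:] = smult (of_real b) (lin_prod {#- 1 / b#})"
    by simp
  then show ?thesis unfolding real_rooted_def by blast
qed

lemma real_rooted_mult:
  assumes "real_rooted p" "real_rooted q"
  shows "real_rooted (p * q)"
proof -
  obtain c A d B where "p = smult (of_real c) (lin_prod A)" "q = smult (of_real d) (lin_prod B)"
    using assms unfolding real_rooted_def by blast
  then have "p * q = smult (of_real (c * d)) (lin_prod (A + B))"
    by (simp add: lin_prod_union mult.commute)
  then show ?thesis unfolding real_rooted_def by blast
qed

lemma real_rooted_one: "real_rooted 1"
  using real_rooted_linear[of 0] by (simp add: one_pCons)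

lemma real_rooted_prod:
  "finite S \<Longrightarrow> (\<And>i. i \<in> S \<Longrightarrow> real_rooted (f i)) \<Longrightarrow> real_rooted (\<Prod>i\<in>S. f i)"
  by (induction S rule: finite_induct) (auto intro: real_rooted_one real_rooted_mult)

text \<open>The sign of \<open>Im (p'/p) = - Im z \<Sum> 1/\<bar>z - a\<bar>\<^sup>2\<close>, cleared of denominators.\<close>

lemma Im_log_deriv_lin_prod:
  assumes "Im z \<noteq> 0"
  shows "lin_prod A \<noteq> 1 \<longrightarrow>
    Im z * Im (poly (pderiv (lin_prod A)) z * cnj (poly (lin_prod A) z)) < 0"
proof (induction A)
  case empty
  then show ?case by simp
next
  case (add a A)
  let ?q = "poly (lin_prod A) z" and ?q' = "poly (pderiv (lin_prod A)) z"
  have "z - of_real b \<noteq> 0" for b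
    using assms by (auto simp: complex_eq_iff)
  then have nz: "?q \<noteq> 0"
    by (induction A) auto
  have "poly (pderiv (lin_prod (add_mset a A))) z = ?q + (z - of_real a) * ?q'"
    unfolding lin_prod_add_mset pderiv_mult by (simp add: pderiv_pCons algebra_simps)
  moreover have "poly (lin_prod (add_mset a A)) z = (z - of_real a) * ?q"
    by (simp add: algebra_simps)
  ultimately have eq: "poly (pderiv (lin_prod (add_mset a A))) z * cnj (poly (lin_prod (add_mset a A)) z)
      = of_real ((cmod ?q)\<^sup>2) * cnj (z - of_real a)
        + of_real ((cmod (z - of_real a))\<^sup>2) * (?q' * cnj ?q)"
    by (simp only: complex_norm_square complex_cnj_mult) (simp add: algebra_simps)
  have "Im z * Im (poly (pderiv (lin_prod (add_mset a A))) z * cnj (poly (lin_prod (add_mset a A)) z))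
      = - ((cmod ?q)\<^sup>2 * (Im z)\<^sup>2) + (cmod (z - of_real a))\<^sup>2 * (Im z * Im (?q' * cnj ?q))"
    unfolding eq by (simp add: algebra_simps power2_eq_square)
  \<comment> \<open>For \<open>lin_prod A = 1\<close> the derivative vanishes and only this weak
    sign holds; strictness comes from the other term.\<close>
  moreover have "Im z * Im (?q' * cnj ?q) \<le> 0"
    using add by (cases "lin_prod A = 1") auto
  then have "(cmod (z - of_real a))\<^sup>2 * (Im z * Im (?q' * cnj ?q)) \<le> 0"
    by (simp add: mult_nonneg_nonpos)
  moreover have "(cmod ?q)\<^sup>2 * (Im z)\<^sup>2 > 0" using nz assms by simp
  ultimately show ?case by linarith
qed

text \<open>By \<open>Im_log_deriv_lin_prod\<close> the derivative of a nonconstant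
  \<open>lin_prod A\<close> has no nonreal zero, so its complex factorization is already one over
  real roots; multiple roots need no separate count.\<close>

lemma real_rooted_pderiv:
  assumes "real_rooted p"
  shows "real_rooted (pderiv p)"
proof (cases "pderiv p = 0")
  case True
  then have "pderiv p = smult (of_real 0) (lin_prod {#})" by simp
  then show ?thesis unfolding real_rooted_def by blast
next
  case False
  obtain c A where p: "p = smult (of_real c) (lin_prod A)"
    using assms unfolding real_rooted_def by blast
  have c: "c \<noteq> 0" and A: "lin_prod A \<noteq> 1" using False p by auto
  have real: "of_real (Re z) = z" if z: "poly (pderiv p) z = 0" for z
  proof -
    have "poly (pderiv (lin_prod A)) z = 0" using z c by (simp add: p pderiv_smult)
    then have "Im z = 0" using Im_log_deriv_lin_prod[of z A] A by fastforce
    then show ?thesis by (simp add: complex_eq_iff)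
  qed
  have "lead_coeff (pderiv p) = of_real (real (degree p) * c)"
  proof -
    have "degree p \<noteq> 0" using False by (metis pderiv_eq_0_iff)
    have "lead_coeff (pderiv p) = of_nat (degree p) * lead_coeff p"
      using \<open>degree p \<noteq> 0\<close> by (simp add: degree_pderiv coeff_pderiv del: of_nat_Suc)
    also have "lead_coeff p = of_real c"
      using lead_coeff_lin_prod[of A] by (simp add: p)
    finally show ?thesis by simp
  qed
  \<comment> \<open>All zeros being real, passing to real parts changes no factor.\<close>
  moreover have "(\<Prod>x\<in>#proots (pderiv p). [:- x, 1:]) = lin_prod (image_mset Re (proots (pderiv p)))"
    unfolding lin_prod_def multiset.map_comp
    using real False by (intro arg_cong[where f=prod_mset] image_mset_cong) (auto simp: o_def)
  ultimately have "pderiv p = smult (of_real (real (degree p) * c)) (lin_prod (image_mset Re (proots (pderiv p))))"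
    using complex_poly_decompose_multiset[of "pderiv p"] by simp
  then show ?thesis unfolding real_rooted_def by blast
qed

lemma real_rooted_higher_pderiv: "real_rooted p \<Longrightarrow> real_rooted ((pderiv ^^ m) p)"
  by (induction m) (auto intro: real_rooted_pderiv)

text \<open>Laguerre's inequality \<open>p'\<^sup>2 \<ge> p p''\<close> at the origin.\<close>

lemma lin_prod_Laguerre:
  "\<exists>x y w::real. coeff (lin_prod A) 0 = of_real x \<and> coeff (lin_prod A) 1 = of_real y \<and>
     coeff (lin_prod A) 2 = of_real w \<and> 2 * x * w \<le> y\<^sup>2"
proof (induction A)
  case empty
  show ?case by (intro exI[of _ 1] exI[of _ 0]) (simp add: coeff_eq_0)
next
  case (add a A)
  then obtain x y w where *: "coeff (lin_prod A) 0 = of_real x" "coeff (lin_prod A) 1 = of_real y"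
     "coeff (lin_prod A) 2 = of_real w" "2 * x * w \<le> y\<^sup>2" by blast
  \<comment> \<open>The factor \<open>X - a\<close> turns \<open>y^2 - 2 x w\<close> into
    \<open>x^2 + a^2 (y^2 - 2 x w)\<close>; the 2 appears because \<open>w\<close> is half the
    second derivative.\<close>
  have "2 * (- a * x) * (y - a * w) \<le> (x - a * y)\<^sup>2"
  proof -
    have "(x - a * y)\<^sup>2 - 2 * (- a * x) * (y - a * w) = x\<^sup>2 + a\<^sup>2 * (y\<^sup>2 - 2 * x * w)"
      by (simp add: power2_eq_square algebra_simps)
    also have "\<dots> \<ge> 0" using *(4) by simp
    finally show ?thesis by simp
  qed
  moreover have "coeff (lin_prod (add_mset a A)) 0 = of_real (- a * x)"
    "coeff (lin_prod (add_mset a A)) 1 = of_real (x - a * y)"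
    "coeff (lin_prod (add_mset a A)) 2 = of_real (y - a * w)"
    using * by (simp_all add: numeral_2_eq_2)
  ultimately show ?case by blast
qed

lemma real_rooted_Laguerre:
  assumes "real_rooted p" "coeff p 0 = of_real x" "coeff p 1 = of_real y" "coeff p 2 = of_real w"
  shows "2 * x * w \<le> y\<^sup>2"
proof -
  obtain c A where p: "p = smult (of_real c) (lin_prod A)"
    using assms unfolding real_rooted_def by blast
  obtain x' y' w' where *: "coeff (lin_prod A) 0 = of_real x'" "coeff (lin_prod A) 1 = of_real y'"
     "coeff (lin_prod A) 2 = of_real w'" "2 * x' * w' \<le> y'\<^sup>2"
    using lin_prod_Laguerre by blast
  have "complex_of_real x = of_real (c * x')" "complex_of_real y = of_real (c * y')"
    "complex_of_real w = of_real (c * w')"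
    using assms(2-4) * by (simp_all add: p)
  then have "x = c * x'" "y = c * y'" "w = c * w'" by (simp_all only: of_real_eq_iff)
  moreover have "c\<^sup>2 * (2 * x' * w') \<le> c\<^sup>2 * y'\<^sup>2" using *(4) by (simp add: mult_left_mono)
  ultimately show ?thesis by (simp add: power2_eq_square algebra_simps)
qed

subsection \<open>Elementary symmetric polynomials\<close>

lemma esym_0 [simp]:
  assumes "finite S"
  shows "esym 0 S F = 1"
proof -
  have "{T. T \<subseteq> S \<and> card T = 0} = {{}}"
    using assms finite_subset by fastforce
  then show ?thesis by (simp add: esym_def)
qed

lemma esym_insert:
  assumes "finite S" "a \<notin> S"
  shows "esym (Suc m) (insert a S) F = esym (Suc m) S F + F a * esym m S F"
proof -
  let ?A = "\<lambda>m. {T. T \<subseteq> S \<and> card T = m}"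
  have fin: "finite (?A m)" for m using assms by simp
  have inj: "inj_on (insert a) (?A m)"
    using assms by (intro inj_onI) (metis (no_types, lifting) Diff_insert_absorb in_mono mem_Collect_eq)
  have "{T. T \<subseteq> insert a S \<and> card T = Suc m} = ?A (Suc m) \<union> insert a ` ?A m"
  proof (intro equalityI subsetI)
    fix T assume T: "T \<in> {T. T \<subseteq> insert a S \<and> card T = Suc m}"
    show "T \<in> ?A (Suc m) \<union> insert a ` ?A m"
    proof (cases "a \<in> T")
      case True
      then have "T = insert a (T - {a})" "T - {a} \<in> ?A m" using T by auto
      then show ?thesis by blast
    qed (use T in auto)
  next
    fix T assume "T \<in> ?A (Suc m) \<union> insert a ` ?A m"
    moreover have "card (insert a U) = Suc (card U)" if "U \<subseteq> S" for U
      using that assms finite_subset by (metis card_insert_disjoint in_mono)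
    ultimately show "T \<in> {T. T \<subseteq> insert a S \<and> card T = Suc m}" by auto
  qed
  moreover have "?A (Suc m) \<inter> insert a ` ?A m = {}" using assms by auto
  ultimately have "esym (Suc m) (insert a S) F
      = esym (Suc m) S F + (\<Sum>T\<in>insert a ` ?A m. \<Prod>i\<in>T. F i)"
    using fin by (simp add: esym_def sum.union_disjoint)
  also have "(\<Sum>T\<in>insert a ` ?A m. \<Prod>i\<in>T. F i) = (\<Sum>T\<in>?A m. F a * (\<Prod>i\<in>T. F i))"
  proof (subst sum.reindex[OF inj], rule sum.cong[OF refl])
    fix T assume "T \<in> ?A m"
    then have "finite T" "a \<notin> T" using assms finite_subset by auto
    then show "((\<lambda>T. \<Prod>i\<in>T. F i) \<circ> insert a) T = F a * (\<Prod>i\<in>T. F i)" by simp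
  qed
  finally show ?thesis by (simp add: esym_def sum_distrib_left)
qed

lemma esym_remove:
  assumes "finite S" "i \<in> S"
  shows "esym (Suc m) S F = esym (Suc m) (S - {i}) F + F i * esym m (S - {i}) F"
  using esym_insert[of "S - {i}" i m F] assms by (simp add: insert_absorb)

lemma esym_eq_0:
  assumes "finite S" "card S < m"
  shows "esym m S F = 0"
proof -
  have "{T. T \<subseteq> S \<and> card T = m} = {}"
    using assms card_mono by (fastforce simp: not_le[symmetric])
  then show ?thesis unfolding esym_def by (simp only: sum.empty)
qed

text \<open>Vieta's formulas: multiplying by one more factor reproduces the recursion
  \<open>esym_insert\<close>.\<close>

lemma coeff_prod_esym:
  assumes "finite S"
  shows "coeff (\<Prod>i\<in>S. [:1, of_real (F i):]) j = (of_real (esym j S F) :: complex)"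
  using assms
proof (induction S arbitrary: j rule: finite_induct)
  case empty
  show ?case by (cases j) (auto simp: esym_eq_0)
next
  case (insert a S)
  then show ?case by (cases j) (simp_all add: esym_insert)
qed

text \<open>A weak form of Newton's inequality: Laguerre's inequality for the \<open>m\<close>-th derivative
  of the generating polynomial \<open>\<Prod>(1 + F i x)\<close>.\<close>

lemma esym_log_concave:
  assumes "finite S"
  shows "esym m S F * esym (Suc (Suc m)) S F \<le> (esym (Suc m) S F)\<^sup>2"
proof -
  define p where "p = (pderiv ^^ m) (\<Prod>i\<in>S. [:1, complex_of_real (F i):])"
  have coeff_p: "coeff p j = of_real (pochhammer (real (Suc j)) m * esym (j + m) S F)" for j
  proof -
    have "pochhammer (complex_of_nat (Suc j)) m = of_real (pochhammer (real (Suc j)) m)"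
      by (simp only: pochhammer_of_real[symmetric] of_real_of_nat_eq)
    then show ?thesis
      unfolding p_def coeff_higher_pderiv coeff_prod_esym[OF assms] by (simp only: of_real_mult)
  qed
  have "real_rooted p"
    unfolding p_def using assms
    by (intro real_rooted_higher_pderiv real_rooted_prod real_rooted_linear)
  from real_rooted_Laguerre[OF this coeff_p coeff_p coeff_p]
  have main: "2 * (pochhammer 1 m * esym m S F) * (pochhammer 3 m * esym (Suc (Suc m)) S F)
      \<le> (pochhammer 2 m * esym (Suc m) S F)\<^sup>2"
    by (simp add: add.commute)
  \<comment> \<open>The Pochhammer values are \<open>m!\<close>, \<open>(m+1)!\<close> and
    \<open>(m+2)!/2\<close>; dividing out leaves the factors \<open>m + 2\<close> and
    \<open>m + 1\<close>.\<close>
  have f1: "pochhammer 1 m = (fact m :: real)" by (simp add: pochhammer_fact)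
  have f2: "pochhammer 2 m = (fact m * (real m + 1) :: real)"
    using pochhammer_rec[of "1::real" m] by (simp add: pochhammer_fact[symmetric] ac_simps)
  have f3: "2 * pochhammer 3 m = (fact m * (real m + 1) * (real m + 2) :: real)"
    using pochhammer_rec[of "2::real" m] pochhammer_rec'[of "2::real" m] f2 by (simp add: algebra_simps)
  let ?x = "esym m S F * esym (Suc (Suc m)) S F"
  have "((fact m)\<^sup>2 * (real m + 1)) * ((real m + 2) * ?x)
      = (pochhammer 1 m * esym m S F) * ((2 * pochhammer 3 m) * esym (Suc (Suc m)) S F)"
    unfolding f1 f3 by (simp add: power2_eq_square algebra_simps)
  also have "\<dots> \<le> (pochhammer 2 m * esym (Suc m) S F)\<^sup>2" using main by (simp add: algebra_simps)
  also have "\<dots> = ((fact m)\<^sup>2 * (real m + 1)) * ((real m + 1) * (esym (Suc m) S F)\<^sup>2)"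
    unfolding f2 by (simp add: power2_eq_square algebra_simps)
  finally have *: "(real m + 2) * ?x \<le> (real m + 1) * (esym (Suc m) S F)\<^sup>2"
    by (subst (asm) mult_le_cancel_left_pos) auto
  \<comment> \<open>Weakening \<open>m + 2\<close> to \<open>m + 1\<close> on the left is valid only
    for \<open>?x \<ge> 0\<close>; a nonpositive \<open>?x\<close> lies below any square.\<close>
  show ?thesis
  proof (cases "?x \<le> 0")
    case True
    then show ?thesis by (meson order_trans zero_le_power2)
  next
    case False
    then have "(real m + 1) * ?x \<le> (real m + 2) * ?x" by (intro mult_right_mono) auto
    with * have "(real m + 1) * ?x \<le> (real m + 1) * (esym (Suc m) S F)\<^sup>2" by linarith
    then show ?thesis by (subst (asm) mult_le_cancel_left_pos) auto
  qed
qed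

text \<open>Induction on \<open>j\<close>, writing \<open>a j\<close> for
  \<open>esym j (S - {i}) F\<close>. If \<open>a (j+1) \<le> 0\<close> while \<open>a j > 0\<close>,
  then multiplying \<open>a (j+1) + F i * a j > 0\<close> by \<open>a (j+1)\<close>, multiplying
  \<open>a (j+2) + F i * a (j+1) > 0\<close> by \<open>a j\<close> and subtracting gives
  \<open>a j * a (j+2) > a (j+1)^2\<close>, against log-concavity. Reaching \<open>a (j+1)\<close>
  uses the cone condition up to index \<open>j+2\<close>, whence \<open>j < k\<close> and not
  \<open>j \<le> k\<close>.\<close>

lemma in_Gamma_remove:
  assumes "finite S" "i \<in> S" "in_Gamma k S F" "j < k"
  shows "esym j (S - {i}) F > 0"
  using assms(4)
proof (induction j)
  case 0
  then show ?case using assms by simp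
next
  case (Suc j)
  let ?a = "\<lambda>m. esym m (S - {i}) F"
  have pos: "?a j > 0" using Suc by simp
  have 1: "?a (Suc j) + F i * ?a j > 0"
    using assms Suc.prems esym_remove[OF assms(1,2), of j F]
    unfolding in_Gamma_def by (metis One_nat_def Suc_leI le_add1 less_imp_le plus_1_eq_Suc)
  have 2: "?a (Suc (Suc j)) + F i * ?a (Suc j) > 0"
    using assms Suc.prems esym_remove[OF assms(1,2), of "Suc j" F]
    unfolding in_Gamma_def by (metis Suc_leI le_add1 plus_1_eq_Suc)
  show ?case
  proof (rule ccontr)
    assume "\<not> ?thesis"
    then have "?a (Suc j) * (?a (Suc j) + F i * ?a j) \<le> 0"
      using 1 by (simp add: mult_nonpos_nonneg)
    moreover have "0 < ?a j * (?a (Suc (Suc j)) + F i * ?a (Suc j))" using pos 2 by simp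
    moreover have "?a j * ?a (Suc (Suc j)) \<le> (?a (Suc j))\<^sup>2"
      using assms(1) by (intro esym_log_concave) auto
    ultimately show False by (simp add: algebra_simps power2_eq_square)
  qed
qed

section \<open>Bounds for quotients of elementary symmetric polynomials\<close>

lemma sum_esym_remove:
  assumes "finite S"
  shows "(\<Sum>i\<in>S. esym j (S - {i}) F) = (real (card S) - real j) * esym j S F"
proof -
  let ?A = "{T. T \<subseteq> S \<and> card T = j}"
  have "(\<Sum>i\<in>S. esym j (S - {i}) F) = (\<Sum>i\<in>S. \<Sum>T | T \<in> ?A \<and> i \<notin> T. \<Prod>i\<in>T. F i)"
    unfolding esym_def by (intro sum.cong refl) auto
  \<comment> \<open>Double counting: a \<open>j\<close>-subset \<open>T\<close> is counted once for
    each of the \<open>card S - j\<close> indices outside it.\<close>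
  also have "\<dots> = (\<Sum>T\<in>?A. \<Sum>i | i \<in> S \<and> i \<notin> T. \<Prod>i\<in>T. F i)"
    using assms by (intro sum.swap_restrict) auto
  also have "\<dots> = (\<Sum>T\<in>?A. (real (card S) - real j) * (\<Prod>i\<in>T. F i))"
  proof (intro sum.cong refl)
    fix T assume "T \<in> ?A"
    then have "T \<subseteq> S" "card T = j" "finite T" using assms finite_subset by auto
    then have "real (card (S - T)) = real (card S) - real j"
      using assms by (metis card_Diff_subset card_mono of_nat_diff)
    moreover have "{i. i \<in> S \<and> i \<notin> T} = S - T" by auto
    ultimately show "(\<Sum>i | i \<in> S \<and> i \<notin> T. \<Prod>i\<in>T. F i) = (real (card S) - real j) * (\<Prod>i\<in>T. F i)"
      by simp
  qed
  finally show ?thesis by (simp add: esym_def sum_distrib_left)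
qed

text \<open>Euler's identity for homogeneous polynomials, derived from \<open>esym_remove\<close>
  and the preceding count at \<open>Suc j\<close>.\<close>

lemma sum_mult_esym_remove:
  assumes "finite S"
  shows "(\<Sum>i\<in>S. F i * esym j (S - {i}) F) = (real j + 1) * esym (Suc j) S F"
proof -
  have "(\<Sum>i\<in>S. F i * esym j (S - {i}) F) = (\<Sum>i\<in>S. esym (Suc j) S F - esym (Suc j) (S - {i}) F)"
    using assms by (intro sum.cong refl) (simp add: esym_remove)
  also have "\<dots> = (real j + 1) * esym (Suc j) S F"
    by (simp add: sum_subtractf sum_esym_remove[OF assms] algebra_simps)
  finally show ?thesis .
qed

text \<open>The equality case of the one-step bounds, at the vector \<open>(1, ..., 1)\<close>; it
  lets their factors telescope into binomials.\<close>

lemma binomial_Suc_real: "(real j + 1) * real (N choose Suc j) = (real N - real j) * real (N choose j)"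
proof (cases "j \<le> N")
  case True
  have "Suc j * (N choose Suc j) = (N - j) * (N choose j)"
    by (metis binomial_absorption binomial_absorb_comp)
  then have "real (Suc j * (N choose Suc j)) = real ((N - j) * (N choose j))" by simp
  then show ?thesis using True by (simp add: of_nat_diff algebra_simps)
qed (simp add: binomial_eq_0)

text \<open>Each \<open>F i\<close> in Euler's identity is replaced by \<open>c\<close>; the weights
  are positive by \<open>in_Gamma_remove\<close>.\<close>

lemma esym_ratio_step_le:
  assumes "finite S" "in_Gamma k S F" "j < k" "\<And>i. i \<in> S \<Longrightarrow> F i \<le> c"
  shows "(real j + 1) * esym (Suc j) S F \<le> c * (real (card S) - real j) * esym j S F"
proof -
  have "(real j + 1) * esym (Suc j) S F = (\<Sum>i\<in>S. F i * esym j (S - {i}) F)"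
    using sum_mult_esym_remove[OF assms(1)] by simp
  also have "\<dots> \<le> (\<Sum>i\<in>S. c * esym j (S - {i}) F)"
    using assms(4) less_imp_le[OF in_Gamma_remove[OF assms(1) _ assms(2,3)]]
    by (intro sum_mono mult_right_mono) auto
  also have "\<dots> = c * (real (card S) - real j) * esym j S F"
    by (simp add: sum_distrib_left[symmetric] sum_esym_remove[OF assms(1)])
  finally show ?thesis .
qed

lemma esym_nonneg:
  assumes "\<And>i. i \<in> S \<Longrightarrow> F i \<ge> 0"
  shows "esym j S F \<ge> 0"
  unfolding esym_def using assms by (intro sum_nonneg prod_nonneg) auto

text \<open>As for the upper bound, but the weights are nonnegative because
  \<open>0 \<le> c \<le> F i\<close>.\<close>

lemma esym_ratio_step_ge:
  assumes "finite S" "0 \<le> c" "\<And>i. i \<in> S \<Longrightarrow> c \<le> F i"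
  shows "c * (real (card S) - real j) * esym j S F \<le> (real j + 1) * esym (Suc j) S F"
proof -
  have "c * (real (card S) - real j) * esym j S F = (\<Sum>i\<in>S. c * esym j (S - {i}) F)"
    by (simp add: sum_distrib_left[symmetric] sum_esym_remove[OF assms(1)])
  also have "\<dots> \<le> (\<Sum>i\<in>S. F i * esym j (S - {i}) F)"
    using assms by (intro sum_mono mult_right_mono esym_nonneg) (auto intro: order_trans)
  also have "\<dots> = (real j + 1) * esym (Suc j) S F"
    using sum_mult_esym_remove[OF assms(1)] by simp
  finally show ?thesis .
qed

lemma in_Gamma_esym_pos: "finite S \<Longrightarrow> in_Gamma k S F \<Longrightarrow> j \<le> k \<Longrightarrow> esym j S F > 0"
  by (cases "j = 0") (auto simp: in_Gamma_def)

lemma esym_quotient_le: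
  assumes "finite S" "in_Gamma k S F" "l \<le> k" "k \<le> card S" "0 \<le> c" "\<And>i. i \<in> S \<Longrightarrow> F i \<le> c"
  shows "esym k S F / esym l S F \<le> real (card S choose k) / real (card S choose l) * c ^ (k - l)"
proof -
  have pos: "esym l S F > 0" using in_Gamma_esym_pos assms by blast
  have bl: "real (card S choose l) > 0" using assms by simp
  \<comment> \<open>Cross-multiplied form of the bound for every \<open>j\<close> between
    \<open>l\<close> and \<open>k\<close>. Each step contributes \<open>c (N - j) / (j + 1)\<close>,
    where \<open>k \<le> card S\<close> and \<open>0 \<le> c\<close> keep the multiplier
    nonnegative.\<close>
  have "esym j S F * real (card S choose l) \<le> real (card S choose j) * c ^ (j - l) * esym l S F"
    if "l \<le> j" "j \<le> k" for j
    using that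
  proof (induction j rule: dec_induct)
    case (step j)
    let ?N = "real (card S)"
    have "(real j + 1) * (esym (Suc j) S F * real (card S choose l))
        \<le> c * (?N - real j) * (esym j S F * real (card S choose l))"
      using mult_right_mono[OF esym_ratio_step_le[OF assms(1,2) _ assms(6), where j = j] less_imp_le[OF bl]]
        step.prems by (simp add: algebra_simps)
    also have "\<dots> \<le> c * (?N - real j) * (real (card S choose j) * c ^ (j - l) * esym l S F)"
      using step assms by (intro mult_left_mono) auto
    also have "\<dots> = c * c ^ (j - l) * esym l S F * ((?N - real j) * real (card S choose j))"
      by simp
    also have "\<dots> = (real j + 1) * (real (card S choose Suc j) * c ^ (Suc j - l) * esym l S F)"
      unfolding binomial_Suc_real[symmetric] using step by (simp add: Suc_diff_le)
    finally show ?case by (subst (asm) mult_le_cancel_left_pos) auto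
  qed simp
  from this[of k] show ?thesis using pos bl assms(3) by (simp add: field_simps)
qed

lemma esym_quotient_ge:
  assumes "finite S" "in_Gamma k S F" "l \<le> k" "k \<le> card S" "0 \<le> c" "\<And>i. i \<in> S \<Longrightarrow> c \<le> F i"
  shows "real (card S choose k) / real (card S choose l) * c ^ (k - l) \<le> esym k S F / esym l S F"
proof -
  have pos: "esym l S F > 0" using in_Gamma_esym_pos assms by blast
  have bl: "real (card S choose l) > 0" using assms by simp
  \<comment> \<open>The same telescoping, with the inequality reversed.\<close>
  have "real (card S choose j) * c ^ (j - l) * esym l S F \<le> esym j S F * real (card S choose l)"
    if "l \<le> j" "j \<le> k" for j
    using that
  proof (induction j rule: dec_induct)
    case (step j)
    let ?N = "real (card S)"
    have "(real j + 1) * (real (card S choose Suc j) * c ^ (Suc j - l) * esym l S F)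
        = c * c ^ (j - l) * esym l S F * ((?N - real j) * real (card S choose j))"
      unfolding binomial_Suc_real[symmetric] using step by (simp add: Suc_diff_le)
    also have "\<dots> = c * (?N - real j) * (real (card S choose j) * c ^ (j - l) * esym l S F)"
      by simp
    also have "\<dots> \<le> c * (?N - real j) * (esym j S F * real (card S choose l))"
      using step assms by (intro mult_left_mono) auto
    also have "\<dots> \<le> (real j + 1) * (esym (Suc j) S F * real (card S choose l))"
      using mult_right_mono[OF esym_ratio_step_ge[where F = F and j = j, OF assms(1,5,6)] less_imp_le[OF bl]]
      by (simp add: algebra_simps)
    finally show ?case by (subst (asm) mult_le_cancel_left_pos) auto
  qed simp
  from this[of k] show ?thesis using pos bl assms(3) by (simp add: field_simps)
qed

subsection \<open>Second derivatives and eigenframes\<close>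

lemma DERIV_along_line:
  assumes "(f has_derivative D) (at (a + s *\<^sub>R v))"
  shows "((\<lambda>s. f (a + s *\<^sub>R v)) has_real_derivative D v) (at s)"
proof -
  have "((\<lambda>s. a + s *\<^sub>R v) has_derivative (\<lambda>h. h *\<^sub>R v)) (at s)"
    by (auto intro!: derivative_eq_intros)
  from has_derivative_compose[OF this assms]
  have "((\<lambda>s. f (a + s *\<^sub>R v)) has_derivative (\<lambda>h. D (h *\<^sub>R v))) (at s)" .
  moreover have "D (h *\<^sub>R v) = D v * h" for h
    using has_derivative_linear[OF assms] by (simp add: linear_cmul)
  ultimately show ?thesis by (simp add: has_field_derivative_def)
qed

text \<open>The mean value theorem twice: in direction \<open>v\<close> for the difference of
  \<open>f\<close> along two parallel segments, then in direction \<open>w\<close> for the resulting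
  first derivative.\<close>

lemma second_difference_mvt:
  fixes f :: "'a::real_normed_vector \<Rightarrow> real"
  assumes "t > 0"
    and S: "\<And>s r. 0 \<le> s \<Longrightarrow> s \<le> t \<Longrightarrow> 0 \<le> r \<Longrightarrow> r \<le> t \<Longrightarrow> x + s *\<^sub>R v + r *\<^sub>R w \<in> S"
    and f': "\<And>y. y \<in> S \<Longrightarrow> (f has_derivative f' y) (at y)"
    and g: "\<And>y. y \<in> S \<Longrightarrow> ((\<lambda>y. f' y v) has_derivative g y) (at y)"
  shows "\<exists>s r. 0 < s \<and> s < t \<and> 0 < r \<and> r < t \<and>
    f (x + t *\<^sub>R v + t *\<^sub>R w) - f (x + t *\<^sub>R v) - f (x + t *\<^sub>R w) + f x
      = t * t * g (x + s *\<^sub>R v + r *\<^sub>R w) w"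
proof -
  let ?\<phi> = "\<lambda>s. f ((x + t *\<^sub>R w) + s *\<^sub>R v) - f (x + s *\<^sub>R v)"
  let ?\<phi>' = "\<lambda>s. f' ((x + t *\<^sub>R w) + s *\<^sub>R v) v - f' (x + s *\<^sub>R v) v"
  have "(?\<phi> has_real_derivative ?\<phi>' s) (at s)" if "0 \<le> s" "s \<le> t" for s
  proof (rule DERIV_diff[OF DERIV_along_line[OF f'] DERIV_along_line[OF f']])
    show "x + t *\<^sub>R w + s *\<^sub>R v \<in> S" using S[of s t] that assms(1) by (simp add: algebra_simps)
    show "x + s *\<^sub>R v \<in> S" using S[of s 0] that assms(1) by simp
  qed
  from MVT2[OF assms(1) this] obtain s where s: "0 < s" "s < t" "?\<phi> t - ?\<phi> 0 = t * ?\<phi>' s"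
    by auto
  have "((\<lambda>r. f' (x + s *\<^sub>R v + r *\<^sub>R w) v) has_real_derivative g (x + s *\<^sub>R v + r *\<^sub>R w) w) (at r)"
    if "0 \<le> r" "r \<le> t" for r
    using s that by (intro DERIV_along_line[where f = "\<lambda>y. f' y v"] g S) auto
  from MVT2[OF assms(1) this] obtain r where r: "0 < r" "r < t"
    "f' (x + s *\<^sub>R v + t *\<^sub>R w) v - f' (x + s *\<^sub>R v) v = t * g (x + s *\<^sub>R v + r *\<^sub>R w) w"
    by auto
  have "f (x + t *\<^sub>R v + t *\<^sub>R w) - f (x + t *\<^sub>R v) - f (x + t *\<^sub>R w) + f x = ?\<phi> t - ?\<phi> 0"
    by (simp add: algebra_simps)
  also have "\<dots> = t * (f' (x + s *\<^sub>R v + t *\<^sub>R w) v - f' (x + s *\<^sub>R v) v)"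
    unfolding s(3) by (simp add: algebra_simps)
  also have "\<dots> = t * t * g (x + s *\<^sub>R v + r *\<^sub>R w) w"
    unfolding r(3) by simp
  finally show ?thesis using s r by blast
qed

text \<open>Schwarz's theorem: the second difference is symmetric in \<open>v\<close> and
  \<open>w\<close>, so the two mixed derivatives agree at points arbitrarily near \<open>x\<close>,
  and continuity carries this to \<open>x\<close>.\<close>

lemma second_derivative_symmetric:
  fixes f :: "'a::real_normed_vector \<Rightarrow> real"
  assumes "open S" "x \<in> S"
    and f': "\<And>y. y \<in> S \<Longrightarrow> (f has_derivative f' y) (at y)"
    and g: "\<And>y. y \<in> S \<Longrightarrow> ((\<lambda>y. f' y v) has_derivative g y) (at y)"
    and h: "\<And>y. y \<in> S \<Longrightarrow> ((\<lambda>y. f' y w) has_derivative h y) (at y)"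
    and cg: "continuous_on S (\<lambda>y. g y w)" and ch: "continuous_on S (\<lambda>y. h y v)"
  shows "g x w = h x v"
proof (rule ccontr)
  assume ne: "g x w \<noteq> h x v"
  define \<epsilon> where "\<epsilon> = dist (g x w) (h x v) / 2"
  have "\<epsilon> > 0" using ne by (simp add: \<epsilon>_def)
  have "isCont (\<lambda>y. g y w) x" "isCont (\<lambda>y. h y v) x"
    using cg ch assms(1,2) by (auto simp: continuous_on_eq_continuous_at)
  then obtain d1 d2 where d: "d1 > 0" "\<And>y. dist y x < d1 \<Longrightarrow> dist (g y w) (g x w) < \<epsilon>"
    "d2 > 0" "\<And>y. dist y x < d2 \<Longrightarrow> dist (h y v) (h x v) < \<epsilon>"
    using \<open>\<epsilon> > 0\<close> unfolding continuous_at_eps_delta by metis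
  obtain d3 where d3: "d3 > 0" "\<And>y. dist y x < d3 \<Longrightarrow> y \<in> S"
    using assms(1,2) unfolding open_dist by blast
  define d where "d = min d1 (min d2 d3)"
  \<comment> \<open>Small enough that the parallelogram with sides \<open>t v\<close>,
    \<open>t w\<close> stays within distance \<open>d\<close> of \<open>x\<close>; the
    \<open>+ 1\<close> covers \<open>v = w = 0\<close>.\<close>
  define t where "t = d / (norm v + norm w + 1)"
  have "d > 0" using d d3 by (simp add: d_def)
  have den: "norm v + norm w + 1 > 0" by (simp add: add_nonneg_pos)
  then have "t > 0" using \<open>d > 0\<close> by (simp add: t_def)
  have close: "dist (x + s *\<^sub>R v + r *\<^sub>R w) x < d" if "0 \<le> s" "s \<le> t" "0 \<le> r" "r \<le> t" for s r
  proof -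
    have "dist (x + s *\<^sub>R v + r *\<^sub>R w) x = norm (s *\<^sub>R v + r *\<^sub>R w)"
      by (simp add: dist_norm algebra_simps)
    also have "\<dots> \<le> s * norm v + r * norm w"
      using norm_triangle_ineq[of "s *\<^sub>R v" "r *\<^sub>R w"] that by simp
    also have "\<dots> \<le> t * norm v + t * norm w"
      using that by (intro add_mono mult_right_mono) auto
    also have "\<dots> < t * (norm v + norm w + 1)" using \<open>t > 0\<close> by (simp add: algebra_simps)
    also have "\<dots> = d" using den by (simp add: t_def)
    finally show ?thesis .
  qed
  let ?\<Delta> = "f (x + t *\<^sub>R v + t *\<^sub>R w) - f (x + t *\<^sub>R v) - f (x + t *\<^sub>R w) + f x"
  have inS: "x + s *\<^sub>R v + r *\<^sub>R w \<in> S" "x + s *\<^sub>R w + r *\<^sub>R v \<in> S"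
    if "0 \<le> s" "s \<le> t" "0 \<le> r" "r \<le> t" for s r
    using d3(2)[of "x + s *\<^sub>R v + r *\<^sub>R w"] d3(2)[of "x + s *\<^sub>R w + r *\<^sub>R v"]
      close[of s r] close[of r s] that
    by (auto simp: d_def algebra_simps)
  obtain s r where sr: "0 < s" "s < t" "0 < r" "r < t" "?\<Delta> = t * t * g (x + s *\<^sub>R v + r *\<^sub>R w) w"
    using second_difference_mvt[where S=S and f=f and f'=f' and g=g, OF \<open>t > 0\<close> inS(1) f' g] by blast
  obtain s' r' where sr': "0 < s'" "s' < t" "0 < r'" "r' < t"
    "f (x + t *\<^sub>R w + t *\<^sub>R v) - f (x + t *\<^sub>R w) - f (x + t *\<^sub>R v) + f x
       = t * t * h (x + s' *\<^sub>R w + r' *\<^sub>R v) v"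
    using second_difference_mvt[where S=S and f=f and f'=f' and g=h, OF \<open>t > 0\<close> inS(2) f' h] by blast
  have "t * t * g (x + s *\<^sub>R v + r *\<^sub>R w) w = t * t * h (x + s' *\<^sub>R w + r' *\<^sub>R v) v"
    using sr(5) sr'(5) by (simp add: algebra_simps)
  then have "g (x + s *\<^sub>R v + r *\<^sub>R w) w = h (x + r' *\<^sub>R v + s' *\<^sub>R w) v"
    using \<open>t > 0\<close> by (simp add: algebra_simps)
  moreover have "dist (g (x + s *\<^sub>R v + r *\<^sub>R w) w) (g x w) < \<epsilon>"
    using close[of s r] sr by (intro d) (auto simp: d_def)
  moreover have "dist (h (x + r' *\<^sub>R v + s' *\<^sub>R w) v) (h x v) < \<epsilon>"
    using close[of r' s'] sr' by (intro d) (auto simp: d_def)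
  ultimately have "dist (g x w) (h x v) < dist (g x w) (h x v)"
    unfolding \<epsilon>_def by (metis dist_triangle_half_r)
  then show False by simp
qed

text \<open>If \<open>L > 0\<close>, then \<open>g'\<close> is positive just to the right of 0, and
  the mean value theorem makes \<open>g\<close> exceed \<open>g 0\<close>.\<close>

lemma second_derivative_local_max:
  fixes g g' :: "real \<Rightarrow> real"
  assumes "\<delta> > 0" and g: "\<And>t. \<bar>t\<bar> < \<delta> \<Longrightarrow> (g has_real_derivative g' t) (at t)"
    and L: "(g' has_real_derivative L) (at 0)"
    and max: "\<And>t. \<bar>t\<bar> < \<delta> \<Longrightarrow> g t \<le> g 0"
  shows "g' 0 = 0" "L \<le> 0"
proof -
  show g'0: "g' 0 = 0"
    using DERIV_local_max[OF g[of 0] assms(1)] max assms(1) by auto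
  show "L \<le> 0"
  proof (rule ccontr)
    assume "\<not> L \<le> 0"
    then obtain d where d: "d > 0" "\<And>h. 0 < h \<Longrightarrow> h < d \<Longrightarrow> g' h > 0"
      using DERIV_pos_inc_right[OF L] g'0 by auto
    define h where "h = min d \<delta> / 2"
    have h: "0 < h" "h < d" "h < \<delta>" using d assms(1) by (auto simp: h_def)
    have "(g has_real_derivative g' t) (at t)" if "0 \<le> t" "t \<le> h" for t
      using that h by (intro g) auto
    from MVT2[OF h(1) this] obtain z where z: "0 < z" "z < h" "g h - g 0 = h * g' z" by auto
    then have "g h - g 0 > 0" using d h by simp
    with max[of h] h show False by auto
  qed
qed

text \<open>A unit vector maximising \<open>B v v\<close> on the unit sphere of \<open>V\<close> is \<open>B\<close>-orthogonal to its
  orthogonal complement in \<open>V\<close>; split it off and induct on the dimension.\<close>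

lemma symmetric_bilinear_diagonalizable:
  fixes B :: "'a::euclidean_space \<Rightarrow> 'a \<Rightarrow> real"
  assumes "bilinear B" and sym: "\<And>v w. B v w = B w v" and "subspace V" and "dim V = d"
  shows "\<exists>e. (\<forall>i<d. e i \<in> V) \<and> (\<forall>i<d. \<forall>j<d. e i \<bullet> e j = (if i = j then 1 else 0)) \<and>
    (\<forall>i<d. \<forall>j<d. i \<noteq> j \<longrightarrow> B (e i) (e j) = 0)"
  using assms(3,4)
proof (induction d arbitrary: V)
  case 0
  then show ?case by simp
next
  case (Suc d)
  have bb: "bounded_bilinear B" using assms(1) by (simp add: bilinear_conv_bounded_bilinear)
  note B = bilinear_ladd[OF assms(1)] bilinear_radd[OF assms(1)]
    bilinear_lmul[OF assms(1)] bilinear_rmul[OF assms(1)]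
  have "V \<noteq> {0}" using Suc.prems(2) by auto
  then obtain a where a: "a \<in> V" "a \<noteq> 0" using subspace_0[OF Suc.prems(1)] by auto
  have "a /\<^sub>R norm a \<in> V \<inter> sphere 0 1"
    using a Suc.prems(1) by (simp add: subspace_scale)
  moreover have "compact (V \<inter> sphere 0 1)"
    using closed_subspace[OF Suc.prems(1)] by (simp add: closed_Int_compact)
  moreover have "continuous_on (V \<inter> sphere 0 1) (\<lambda>v. B v v)"
    by (intro bounded_bilinear.continuous_on[OF bb] continuous_on_id)
  ultimately obtain e0 where e0: "e0 \<in> V" "norm e0 = 1"
    and max: "\<And>v. v \<in> V \<Longrightarrow> norm v = 1 \<Longrightarrow> B v v \<le> B e0 e0"
    using continuous_attains_sup[of "V \<inter> sphere 0 1" "\<lambda>v. B v v"] by fastforce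
  have e0e0: "e0 \<bullet> e0 = 1" using e0 by (simp add: norm_eq_1)
  define M where "M = B e0 e0"
  have quad: "B v v \<le> M * (v \<bullet> v)" if "v \<in> V" for v
  \<comment> \<open>Homogeneity of degree two extends the maximum from the unit sphere to
    \<open>V\<close>.\<close>
  proof (cases "v = 0")
    case True
    then show ?thesis using bilinear_lzero[OF assms(1)] by simp
  next
    case False
    have "B (v /\<^sub>R norm v) (v /\<^sub>R norm v) \<le> M"
      unfolding M_def using that False Suc.prems(1) by (intro max) (simp_all add: subspace_scale)
    then show ?thesis
      using False by (simp add: B dot_square_norm field_simps power2_eq_square)
  qed
  have orth: "B e0 w = 0" if "w \<in> V" "w \<bullet> e0 = 0" for w
  proof -
    define b K where "b = B e0 w" and "K = M * (w \<bullet> w) - B w w"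
    \<comment> \<open>The bound \<open>quad\<close> at the perturbed vector \<open>e0 + t w\<close>;
      the constant terms cancel.\<close>
    have ineq: "2 * t * b \<le> t\<^sup>2 * K" for t
    proof -
      have "e0 + t *\<^sub>R w \<in> V" using e0 that Suc.prems(1) by (simp add: subspace_add subspace_scale)
      from quad[OF this] show ?thesis
        using that(2) e0e0 sym[of w e0]
        by (simp add: B inner_add_left inner_add_right inner_commute[of e0 w] b_def K_def M_def
            power2_eq_square algebra_simps)
    qed
    \<comment> \<open>With \<open>t = c b\<close> and \<open>c K \<le> 1\<close> the inequality
      becomes \<open>2 b^2 \<le> b^2\<close>, so \<open>b = 0\<close>.\<close>
    define c where "c = 1 / (\<bar>K\<bar> + 1)"
    have "c > 0" by (simp add: c_def add_nonneg_pos)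
    have "c * K \<le> 1"
      by (simp add: c_def divide_le_eq add_nonneg_pos)
    have "2 * (c * b) * b \<le> (c * b)\<^sup>2 * K" by (rule ineq)
    then have "c * (2 * b\<^sup>2) \<le> c * (b\<^sup>2 * (c * K))"
      by (simp add: power2_eq_square algebra_simps)
    then have "2 * b\<^sup>2 \<le> b\<^sup>2 * (c * K)" using \<open>c > 0\<close> by simp
    also have "\<dots> \<le> b\<^sup>2 * 1" using \<open>c * K \<le> 1\<close> by (intro mult_left_mono) auto
    finally show ?thesis by (simp add: b_def)
  qed
  define W where "W = {y \<in> V. \<forall>x\<in>span {e0}. orthogonal x y}"
  have W: "y \<in> W \<longleftrightarrow> y \<in> V \<and> y \<bullet> e0 = 0" for y
    by (auto simp: W_def span_singleton orthogonal_def inner_commute)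
  have "dim W + dim (span {e0}) = dim V"
    unfolding W_def using e0 Suc.prems(1)
    by (intro dim_subspace_orthogonal_to_vectors) (auto intro: span_minimal[THEN subsetD])
  moreover have "dim (span {e0}) = 1" using e0 by (auto simp: dim_span)
  ultimately have "dim W = d" using Suc.prems(2) by simp
  moreover have "subspace W"
    using Suc.prems(1) by (auto simp: subspace_def W inner_add_left)
  ultimately obtain e where e: "\<And>i. i < d \<Longrightarrow> e i \<in> W"
    "\<And>i j. i < d \<Longrightarrow> j < d \<Longrightarrow> e i \<bullet> e j = (if i = j then 1 else 0)"
    "\<And>i j. B (e i) (e j) \<noteq> 0 \<Longrightarrow> i < d \<Longrightarrow> j < d \<Longrightarrow> i = j"
    using Suc.IH by metis
  have eW: "e i \<in> V" "e i \<bullet> e0 = 0" "e0 \<bullet> e i = 0" "B e0 (e i) = 0" "B (e i) e0 = 0" if "i < d" for i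
    using e(1)[OF that] orth[of "e i"] sym[of "e i" e0] by (auto simp: W inner_commute)
  show ?case
    by (rule exI[of _ "case_nat e0 e"]) (auto simp: less_Suc_eq_0_disj e0 e0e0 eW e(2) split: if_splits dest: e(3))
qed

section \<open>Hessian, eigenframes and extrema on the sphere\<close>

lemma C2_sphere_has_derivative:
  assumes "C2_sphere u" "x \<noteq> 0"
  shows "(ext0 u has_derivative D1 u x) (at x)"
    and "((\<lambda>y. D1 u y v) has_derivative D2 u x v) (at x)"
proof -
  have "D1 u x = frechet_derivative (ext0 u) (at x)"
    "D2 u x v = frechet_derivative (\<lambda>y. D1 u y v) (at x)"
    by (auto simp: D1_def D2_def fun_eq_iff)
  then show "(ext0 u has_derivative D1 u x) (at x)"
    and "((\<lambda>y. D1 u y v) has_derivative D2 u x v) (at x)"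
    using assms unfolding C2_sphere_def by (simp_all add: frechet_derivative_works[symmetric])
qed

text \<open>Linearity in the first slot is inherited from \<open>D1 u y\<close> near
  \<open>x\<close> by uniqueness of derivatives.\<close>

lemma D2_bilinear:
  assumes "C2_sphere u" "x \<noteq> 0"
  shows "bilinear (D2 u x)"
proof -
  note D = C2_sphere_has_derivative[OF assms(1)]
  have lin: "linear (D1 u y)" if "y \<noteq> 0" for y
    using has_derivative_linear[OF D(1)[OF that]] .
  have "D2 u x (v + w) z = D2 u x v z + D2 u x w z" for v w z
  proof -
    have "((\<lambda>y. D1 u y (v + w)) has_derivative (\<lambda>z. D2 u x v z + D2 u x w z)) (at x)"
      by (rule has_derivative_transform_within_open[OF has_derivative_add[OF D(2) D(2)], of x "- {0}"])
        (use assms lin in \<open>auto simp: linear_add\<close>)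
    then show ?thesis using has_derivative_unique[OF D(2)[OF assms(2)]] by metis
  qed
  moreover have "D2 u x (c *\<^sub>R v) z = c * D2 u x v z" for c v z
  proof -
    have "((\<lambda>y. D1 u y (c *\<^sub>R v)) has_derivative (\<lambda>z. c * D2 u x v z)) (at x)"
      by (rule has_derivative_transform_within_open[OF has_derivative_mult_right[OF D(2)], of x "- {0}"])
        (use assms lin in \<open>auto simp: linear_cmul\<close>)
    then show ?thesis using has_derivative_unique[OF D(2)[OF assms(2)]] by metis
  qed
  moreover have "linear (D2 u x v)" for v using has_derivative_linear[OF D(2)[OF assms(2)]] .
  ultimately show ?thesis by (auto simp: bilinear_def intro!: linearI)
qed

lemma D2_symmetric:
  assumes "C2_sphere u" "x \<noteq> 0"
  shows "D2 u x v w = D2 u x w v"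
  using assms C2_sphere_has_derivative[OF assms(1)]
  by (intro second_derivative_symmetric[of "- {0}" x "ext0 u" "D1 u" v "\<lambda>y. D2 u y v" w "\<lambda>y. D2 u y w"])
    (auto simp: C2_sphere_def)

text \<open>The equation is stated for eigenframes, so one is needed at each point: diagonalise
  \<open>D2 u x\<close> on the hyperplane orthogonal to \<open>x\<close>; adding \<open>u x\<close>
  shifts the eigenvalues.\<close>

lemma eigen_frame_exists:
  fixes u :: "real^'m \<Rightarrow> real"
  assumes "C2_sphere u" "x \<noteq> 0"
  shows "\<exists>e. eigen_frame u x (CARD('m) - 1) e (\<lambda>i. D2 u x (e i) (e i) + u x)"
proof -
  have "dim {v. x \<bullet> v = 0} = CARD('m) - 1" using assms(2) by (simp add: dim_hyperplane)
  from symmetric_bilinear_diagonalizable[OF D2_bilinear[OF assms] D2_symmetric[OF assms]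
      subspace_hyperplane this]
  obtain e where "\<forall>i<CARD('m) - 1. e i \<in> {v. x \<bullet> v = 0}"
    "\<forall>i<CARD('m) - 1. \<forall>j<CARD('m) - 1. e i \<bullet> e j = (if i = j then 1 else 0)"
    "\<forall>i<CARD('m) - 1. \<forall>j<CARD('m) - 1. i \<noteq> j \<longrightarrow> D2 u x (e i) (e j) = 0"
    by (elim exE conjE) (rule that)
  then show ?thesis
    by (intro exI[of _ e]) (auto simp: eigen_frame_def tangent_frame_def inner_commute)
qed

text \<open>By 0-homogeneity \<open>x\<close> is also an extremum of \<open>ext0 u\<close> along
  every straight line through \<open>x\<close>, where the one-variable test applies. The sign of
  \<open>c\<close> selects maximum or minimum.\<close>

lemma sphere_extremum_derivatives:
  assumes "C2_sphere u" "norm x = 1" and ext: "\<And>y. norm y = 1 \<Longrightarrow> c * u y \<le> c * u x" and "c \<noteq> 0"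
  shows "D1 u x v = 0" "c * D2 u x v v \<le> 0"
proof -
  \<comment> \<open>For \<open>\<bar>t\<bar> < \<delta>\<close> the displacement \<open>t v\<close>
    is shorter than 1, so the line avoids the origin.\<close>
  define \<delta> where "\<delta> = 1 / (norm v + 1)"
  have den: "norm v + 1 > 0" by (simp add: add_nonneg_pos)
  then have "\<delta> > 0" by (simp add: \<delta>_def)
  have nz: "x + t *\<^sub>R v \<noteq> 0" if "\<bar>t\<bar> < \<delta>" for t
  proof
    assume "x + t *\<^sub>R v = 0"
    then have "norm x = norm (t *\<^sub>R v)" by (metis add_eq_0_iff norm_minus_cancel)
    then have "1 = \<bar>t\<bar> * norm v" using assms(2) by simp
    also have "\<dots> \<le> \<bar>t\<bar> * (norm v + 1)" by (simp add: algebra_simps)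
    also have "\<dots> < \<delta> * (norm v + 1)" using that den by (intro mult_strict_right_mono)
    also have "\<dots> = 1" using den by (simp add: \<delta>_def)
    finally show False by simp
  qed
  let ?g = "\<lambda>t. c * ext0 u (x + t *\<^sub>R v)" and ?g' = "\<lambda>t. c * D1 u (x + t *\<^sub>R v) v"
  have 1: "(?g has_real_derivative ?g' t) (at t)" if "\<bar>t\<bar> < \<delta>" for t
    using nz[OF that] by (intro DERIV_cmult DERIV_along_line C2_sphere_has_derivative assms)
  have "x + 0 *\<^sub>R v \<noteq> 0" using nz[of 0] \<open>\<delta> > 0\<close> by simp
  from DERIV_cmult[OF DERIV_along_line[OF C2_sphere_has_derivative(2)[OF assms(1) this, of v]], of c]
  have 2: "(?g' has_real_derivative c * D2 u x v v) (at 0)" by simp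
  have 3: "?g t \<le> ?g 0" if "\<bar>t\<bar> < \<delta>" for t
    using nz[OF that] assms(2) ext[of "(x + t *\<^sub>R v) /\<^sub>R norm (x + t *\<^sub>R v)"] by (simp add: ext0_def)
  from second_derivative_local_max[OF \<open>\<delta> > 0\<close> 1 2 3] show "D1 u x v = 0" "c * D2 u x v v \<le> 0"
    using \<open>c \<noteq> 0\<close> by simp_all
qed

subsection \<open>The maximum principle argument\<close>

lemma card_multi_indices: "finite (multi_indices n P)" "card (multi_indices n P) = n choose P"
  using n_subsets[of "{..<n}" P] by (simp_all add: multi_indices_def)

lemma Lam_le:
  assumes "\<And>i. i < n \<Longrightarrow> lam i \<le> c" "I \<in> multi_indices n P"
  shows "Lam lam I \<le> real P * c"
  using sum_bounded_above[of I lam c] assms by (auto simp: multi_indices_def Lam_def)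

lemma Lam_ge:
  assumes "\<And>i. i < n \<Longrightarrow> c \<le> lam i" "I \<in> multi_indices n P"
  shows "real P * c \<le> Lam lam I"
  using sum_bounded_below[of I c lam] assms by (auto simp: multi_indices_def Lam_def)

theorem theorem5p1:
  fixes u \<phi> :: "real^'m \<Rightarrow> real" and P k l :: nat and p q \<epsilon> :: real
  defines "n \<equiv> CARD('m) - 1"
  defines "N \<equiv> n choose P"
  assumes "n \<ge> 2" and "1 < P" and "P \<le> n - 1"
    and "l < k" and "k \<le> N"
    and "p = q - real l" and "p > 1" and "\<epsilon> > 0"
    and "continuous_on (sphere 0 1) \<phi>" and "\<forall>x\<in>sphere 0 1. \<phi> x > 0"
    and "C2_sphere u" and "\<forall>x\<in>sphere 0 1. u x > 0"
    and "\<forall>x\<in>sphere 0 1. \<forall>e lam. eigen_frame u x n e lam \<longrightarrow>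
           in_Gamma k (multi_indices n P) (Lam lam) \<and>
           esym k (multi_indices n P) (Lam lam) / esym l (multi_indices n P) (Lam lam)
             = u x powr (p - 1 + \<epsilon>)
               * (u x ^ 2 + (\<Sum>i<n. (D1 u x (e i))^2)) powr ((real k + 1 - q) / 2)
               * \<phi> x"
  shows "\<forall>x\<in>sphere 0 1.
           real (N choose k) / real (N choose l) * real P ^ (k - l) / (SUP y\<in>sphere 0 1. \<phi> y)
             \<le> u x powr \<epsilon> \<and>
           u x powr \<epsilon> \<le>
           real (N choose k) / real (N choose l) * real P ^ (k - l) / (INF y\<in>sphere 0 1. \<phi> y)"
proof -
  note l_k = \<open>l < k\<close> and k_N = \<open>k \<le> N\<close> and p_q = \<open>p = q - real l\<close>
    and \<phi>_cont = \<open>continuous_on (sphere 0 1) \<phi>\<close> and \<phi>_pos = \<open>\<forall>x\<in>sphere 0 1. \<phi> x > 0\<close>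
    and u_C2 = \<open>C2_sphere u\<close> and u_pos = \<open>\<forall>x\<in>sphere 0 1. u x > 0\<close>
  let ?S = "sphere 0 1 :: (real^'m) set"
  let ?MI = "multi_indices n P"
  define K where "K = real (N choose k) / real (N choose l) * real P ^ (k - l)"
  have S_ne: "?S \<noteq> {}" by simp
  have card_MI: "card ?MI = N" by (simp add: N_def card_multi_indices)

  \<comment> \<open>Both extrema at once, through the sign of \<open>c\<close>. The gradient term
    vanishes, so the powers of \<open>u\<close> combine to
    \<open>p - 1 + \<epsilon> + (k + 1 - q) = \<epsilon> + (k - l)\<close>.\<close>
  have extremum: "\<exists>lam. (\<forall>i<n. c * lam i \<le> c * u x) \<and> in_Gamma k ?MI (Lam lam) \<and>
      esym k ?MI (Lam lam) / esym l ?MI (Lam lam) = u x powr \<epsilon> * \<phi> x * u x ^ (k - l)"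
    if x: "x \<in> ?S" and c: "c \<noteq> 0" "\<And>y. y \<in> ?S \<Longrightarrow> c * u y \<le> c * u x" for x and c :: real
  proof -
    have "x \<noteq> 0" using x by auto
    have ux: "u x > 0" using u_pos x by blast
    obtain e where e: "eigen_frame u x n e (\<lambda>i. D2 u x (e i) (e i) + u x)"
      using eigen_frame_exists[OF u_C2 \<open>x \<noteq> 0\<close>] unfolding n_def by blast
    have D: "D1 u x v = 0" "c * D2 u x v v \<le> 0" for v
      using sphere_extremum_derivatives[OF u_C2, of x c v] x c by auto
    have "u x powr (p - 1 + \<epsilon>) * (u x ^ 2 + (\<Sum>i<n. (D1 u x (e i))\<^sup>2)) powr ((real k + 1 - q) / 2) * \<phi> x
        = u x powr (p - 1 + \<epsilon>) * (u x powr 2) powr ((real k + 1 - q) / 2) * \<phi> x"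
      using ux by (simp add: D(1))
    also have "\<dots> = u x powr (p - 1 + \<epsilon> + (real k + 1 - q)) * \<phi> x"
    proof -
      have "2 * ((real k + 1 - q) / 2) = real k + 1 - q" by simp
      then show ?thesis by (simp only: powr_powr powr_add)
    qed
    also have "p - 1 + \<epsilon> + (real k + 1 - q) = \<epsilon> + real (k - l)"
      using l_k p_q by simp
    also have "u x powr (\<epsilon> + real (k - l)) * \<phi> x = u x powr \<epsilon> * \<phi> x * u x ^ (k - l)"
      using ux by (simp add: powr_add powr_realpow)
    finally have "u x powr (p - 1 + \<epsilon>)
        * (u x ^ 2 + (\<Sum>i<n. (D1 u x (e i))\<^sup>2)) powr ((real k + 1 - q) / 2) * \<phi> x
        = u x powr \<epsilon> * \<phi> x * u x ^ (k - l)" .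
    note eq = assms(15)[rule_format, OF x e, unfolded this]
    have "c * (D2 u x (e i) (e i) + u x) \<le> c * u x" for i
      using D(2)[of "e i"] by (simp add: algebra_simps)
    with eq show ?thesis by (intro exI[of _ "\<lambda>i. D2 u x (e i) (e i) + u x"]) auto
  qed

  \<comment> \<open>Regularity is given for \<open>ext0 u\<close>, which agrees with
    \<open>u\<close> on the sphere.\<close>
  have "continuous_on ?S (ext0 u)"
    using u_C2 unfolding C2_sphere_def
    by (intro continuous_at_imp_continuous_on ballI differentiable_imp_continuous_within)
      (metis mem_sphere_0 norm_zero zero_neq_one)
  then have u_cont: "continuous_on ?S u"
    by (rule continuous_on_eq) (simp add: ext0_def)
  obtain x0 where x0: "x0 \<in> ?S" "\<And>y. y \<in> ?S \<Longrightarrow> u y \<le> u x0"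
    using continuous_attains_sup[OF compact_sphere S_ne u_cont] by blast
  obtain x1 where x1: "x1 \<in> ?S" "\<And>y. y \<in> ?S \<Longrightarrow> u x1 \<le> u y"
    using continuous_attains_inf[OF compact_sphere S_ne u_cont] by blast
  \<comment> \<open>The extrema of \<open>\<phi>\<close> are attained, so \<open>INF\<close> and
    \<open>SUP\<close> are values of \<open>\<phi>\<close> and hence positive.\<close>
  obtain y0 where y0: "y0 \<in> ?S" "\<And>y. y \<in> ?S \<Longrightarrow> \<phi> y0 \<le> \<phi> y"
    using continuous_attains_inf[OF compact_sphere S_ne \<phi>_cont] by blast
  obtain y1 where y1: "y1 \<in> ?S" "\<And>y. y \<in> ?S \<Longrightarrow> \<phi> y \<le> \<phi> y1"
    using continuous_attains_sup[OF compact_sphere S_ne \<phi>_cont] by blast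
  have Inf: "(INF y\<in>?S. \<phi> y) = \<phi> y0" using y0 by (intro cInf_eq_minimum) auto
  have Sup: "(SUP y\<in>?S. \<phi> y) = \<phi> y1" using y1 by (intro cSup_eq_maximum) auto
  have pos: "u x0 > 0" "u x1 > 0" "\<phi> y0 > 0" "\<phi> y1 > 0" using u_pos \<phi>_pos x0 x1 y0 y1 by blast+

  have upper: "u x0 powr \<epsilon> * \<phi> x0 \<le> K"
  proof -
    obtain lam where lam: "\<And>i. i < n \<Longrightarrow> lam i \<le> u x0" "in_Gamma k ?MI (Lam lam)"
      "esym k ?MI (Lam lam) / esym l ?MI (Lam lam) = u x0 powr \<epsilon> * \<phi> x0 * u x0 ^ (k - l)"
      using extremum[OF x0(1), of 1] x0(2) by auto
    have "u x0 powr \<epsilon> * \<phi> x0 * u x0 ^ (k - l)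
        \<le> real (N choose k) / real (N choose l) * (real P * u x0) ^ (k - l)"
      unfolding lam(3)[symmetric] card_MI[symmetric]
      using l_k k_N pos Lam_le[where lam = lam, OF lam(1)] lam(2)
      by (intro esym_quotient_le) (auto simp: card_multi_indices N_def)
    then have "u x0 powr \<epsilon> * \<phi> x0 * u x0 ^ (k - l) \<le> K * u x0 ^ (k - l)"
      by (simp add: K_def power_mult_distrib)
    then show ?thesis using pos by simp
  qed

  have lower: "K \<le> u x1 powr \<epsilon> * \<phi> x1"
  proof -
    obtain lam where lam: "\<And>i. i < n \<Longrightarrow> u x1 \<le> lam i" "in_Gamma k ?MI (Lam lam)"
      "esym k ?MI (Lam lam) / esym l ?MI (Lam lam) = u x1 powr \<epsilon> * \<phi> x1 * u x1 ^ (k - l)"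
      \<comment> \<open>Taking \<open>c = - 1\<close> turns the eigenvalue bound into
        \<open>u x1 \<le> lam i\<close>.\<close>
      using extremum[OF x1(1), of "- 1"] x1(2) by auto
    have "real (N choose k) / real (N choose l) * (real P * u x1) ^ (k - l)
        \<le> u x1 powr \<epsilon> * \<phi> x1 * u x1 ^ (k - l)"
      unfolding lam(3)[symmetric] card_MI[symmetric]
      using l_k k_N pos Lam_ge[where lam = lam, OF lam(1)] lam(2)
      by (intro esym_quotient_ge) (auto simp: card_multi_indices N_def)
    then have "K * u x1 ^ (k - l) \<le> u x1 powr \<epsilon> * \<phi> x1 * u x1 ^ (k - l)"
      by (simp add: K_def power_mult_distrib)
    then show ?thesis using pos by simp
  qed

  show ?thesis
    unfolding Inf Sup K_def[symmetric]
  proof (intro ballI conjI)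
    fix x assume x: "x \<in> ?S"
    \<comment> \<open>First \<open>\<phi>\<close> at the extremum of \<open>u\<close> is replaced by
      its own extremum, then monotonicity of \<open>powr \<epsilon>\<close> passes from the extremum
      to \<open>x\<close>.\<close>
    have "K \<le> u x1 powr \<epsilon> * \<phi> y1"
      using lower y1(2)[OF x1(1)] by (meson mult_left_mono order_trans powr_ge_zero)
    then have "K / \<phi> y1 \<le> u x1 powr \<epsilon>" using pos by (simp add: divide_le_eq)
    also have "\<dots> \<le> u x powr \<epsilon>" using x1(2)[OF x] pos \<open>\<epsilon> > 0\<close> by (intro powr_mono2) auto
    finally show "K / \<phi> y1 \<le> u x powr \<epsilon>" .
    have "u x0 powr \<epsilon> * \<phi> y0 \<le> K"
      using upper y0(2)[OF x0(1)] by (meson mult_left_mono order_trans powr_ge_zero)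
    then have "u x0 powr \<epsilon> \<le> K / \<phi> y0" using pos by (simp add: le_divide_eq)
    moreover have "u x powr \<epsilon> \<le> u x0 powr \<epsilon>"
      using x0(2)[OF x] u_pos x \<open>\<epsilon> > 0\<close> by (intro powr_mono2) (auto intro: less_imp_le)
    ultimately show "u x powr \<epsilon> \<le> K / \<phi> y0" by simp
  qed
qed

end
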